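(* Let $\lambda_1\ge\mu_1$ be positive integers. If any of the following conditions holds: (i) $\lambda_1$ and $\mu_1$ are coprime, or (ii) $\lambda_1+1$ and $\mu_1$ are coprime, or (iii) $\lambda_1+1$ and $\mu_1+1$ are coprime and $2\mu_1\ge\lambda_1$, then the pair $(\lambda_1,\mu_1)$ is $(\lambda_1+1)$-initial. Moreover, in each case there is a Hilbert basis element $(\lambda,\mu)$ of $\mathcal{K}_{\lambda_1+1}$ whose partitions have first entries $\lambda_1$ and $\mu_1$ respectively and which lies on a $2$-dimensional face of $\mathcal{K}_{\lambda_1+1}$.
   Context: For a positive integer $r$, a partition with at most $r$ parts is written as a non-increasing $r$-tuple of nonnegative integers; $\mathrm{Par}_r(n)$ is the set of such tuples with entries summing to $n$. For $\lambda,\mu\in\mathrm{Par}_r(n)$, $\lambda$ dominates $\mu$ if $\sum_{i=1}^k\lambda_i\ge\sum_{i=1}^k\mu_i$ for all $k\le r$. The $r$-Kostka cone $\mathcal{K}_r\subseteq\mathbb{R}^{2r}$ is the convex hull of all points $(\lambda_1,\dots,\lambda_r,\mu_1,\dots,\mu_r)$ with $\lambda,\mu\in\mathrm{Par}_r(n)$ for some $n$ and $\lambda$ dominating $\mu$; it is a pointed rational polyhedral cone. Its Hilbert basis is the unique minimal finite set of integer points of $\mathcal{K}_r$ such that every integer point of $\mathcal{K}_r$ is a nonnegative integer combination of them; equivalently, the set of integer points of $\mathcal{K}_r$ that are not nonnegative integer combinations of other integer points of $\mathcal{K}_r$. An integer pair $(\lambda_1,\mu_1)$ is called $r$-initial if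 there is an element $(\lambda,\mu)$ of the Hilbert basis of $\mathcal{K}_r$ such that the first entry of $\lambda$ is $\lambda_1$ and the first entry of $\mu$ is $\mu_1$. *)

theory Defs
  imports "HOL-Analysis.Analysis" "HOL-Analysis.Finite_Function_Topology"
begin

text \<open>
  The dimension \<open>2r\<close> is a term-level parameter, so \<open>\<real>\<^sup>r \<times> \<real>\<^sup>r\<close> is realised inside the
  real vector space of pairs of finitely supported functions on \<open>nat\<close>; the partitions
  spanning the cone are supported on \<open>{1..r}\<close>, hence so is every point of the cone.
\<close>

type_synonym rvec = "nat \<Rightarrow>\<^sub>0 real"

definition Par :: "nat \<Rightarrow> nat \<Rightarrow> (nat \<Rightarrow>\<^sub>0 nat) set" where
  "Par r n = {l. Poly_Mapping.keys l \<subseteq> {1..r} \<and>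
     (\<forall>i\<in>{1..<r}. Poly_Mapping.lookup l (Suc i) \<le> Poly_Mapping.lookup l i) \<and> (\<Sum>i=1..r. Poly_Mapping.lookup l i) = n}"

definition dominates :: "nat \<Rightarrow> (nat \<Rightarrow>\<^sub>0 nat) \<Rightarrow> (nat \<Rightarrow>\<^sub>0 nat) \<Rightarrow> bool" where
  "dominates r l m \<longleftrightarrow> (\<forall>k\<le>r. (\<Sum>i=1..k. Poly_Mapping.lookup l i) \<ge> (\<Sum>i=1..k. Poly_Mapping.lookup m i))"

definition kostka_cone :: "nat \<Rightarrow> (rvec \<times> rvec) set" where
  "kostka_cone r = convex hull
     {(Poly_Mapping.map real l, Poly_Mapping.map real m) | l m n.
        l \<in> Par r n \<and> m \<in> Par r n \<and> dominates r l m}"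

definition integer_points :: "(rvec \<times> rvec) set \<Rightarrow> (rvec \<times> rvec) set" where
  "integer_points C = {x \<in> C. \<forall>i. Poly_Mapping.lookup (fst x) i \<in> \<int> \<and> Poly_Mapping.lookup (snd x) i \<in> \<int>}"

definition nonneg_int_combinations :: "'a::real_vector set \<Rightarrow> 'a set" where
  "nonneg_int_combinations S =
     {(\<Sum>v\<in>A. real (c v) *\<^sub>R v) | A c. finite A \<and> A \<subseteq> S}"

definition hilbert_basis :: "(rvec \<times> rvec) set \<Rightarrow> (rvec \<times> rvec) set" where
  "hilbert_basis C = {x \<in> integer_points C.
     x \<notin> nonneg_int_combinations (integer_points C - {x})}"

definition r_initial :: "nat \<Rightarrow> int \<Rightarrow> int \<Rightarrow> bool" where
  "r_initial r a b \<longleftrightarrow> (\<exists>(l, m) \<in> hilbert_basis (kostka_cone r).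
     Poly_Mapping.lookup l 1 = of_int a \<and> Poly_Mapping.lookup m 1 = of_int b)"

text \<open>
  The dimension of a face is the library's linear \<^const>\<open>dim\<close>. By the following lemma a
  nonempty face contains the origin, so this is also its affine dimension.
\<close>

lemma zero_in_kostka_face:
  assumes F: "F face_of kostka_cone r" and ne: "F \<noteq> {}"
  shows "0 \<in> F"
proof -
  define G where "G = {(Poly_Mapping.map real l, Poly_Mapping.map real m) | l m n.
        l \<in> Par r n \<and> m \<in> Par r n \<and> dominates r l m}"
  have K: "kostka_cone r = convex hull G"
    unfolding kostka_cone_def G_def ..
  have dbl: "2 *\<^sub>R g \<in> G" if "g \<in> G" for g
  proof -
    from that obtain l m n where g: "g = (Poly_Mapping.map real l, Poly_Mapping.map real m)"
      and h: "l \<in> Par r n" "m \<in> Par r n" "dominates r l m"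
      unfolding G_def by blast
    have keys: "Poly_Mapping.keys (p + p) \<subseteq> Poly_Mapping.keys p" for p :: "nat \<Rightarrow>\<^sub>0 nat"
      using keys_add[of p p] by auto
    have par: "p + p \<in> Par r (n + n)" if "p \<in> Par r n" for p
      using that keys[of p] by (auto simp: Par_def lookup_add sum.distrib intro: add_mono)
    have dom: "dominates r (l + l) (m + m)"
      using h(3) by (auto simp: dominates_def lookup_add sum.distrib intro: add_mono)
    have map: "Poly_Mapping.map real (p + p) = 2 *\<^sub>R Poly_Mapping.map real p" for p :: "nat \<Rightarrow>\<^sub>0 nat"
      unfolding scaleR_2
      by (rule poly_mapping_eqI, simp only: lookup_add map.rep_eq) (simp add: when_def)
    show ?thesis
      unfolding G_def using par[OF h(1)] par[OF h(2)] dom by (auto simp: g map[symmetric])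
  qed
  obtain x where x: "x \<in> F" using ne by blast
  then have xK: "x \<in> convex hull G"
    using F face_of_imp_subset K by blast
  have "(\<lambda>v. 2 *\<^sub>R v) ` (convex hull G) = convex hull ((\<lambda>v. 2 *\<^sub>R v) ` G)"
    by (rule convex_hull_linear_image) (simp add: linear_scale_self)
  also have "\<dots> \<subseteq> convex hull G"
    using dbl by (intro hull_mono) auto
  finally have x2: "2 *\<^sub>R x \<in> convex hull G" using xK by blast
  have "(0 :: nat \<Rightarrow>\<^sub>0 nat) \<in> Par r 0" "dominates r 0 0"
    by (auto simp: Par_def dominates_def)
  moreover have "Poly_Mapping.map real (0 :: nat \<Rightarrow>\<^sub>0 nat) = 0"
    by (rule poly_mapping_eqI) (simp add: map.rep_eq)
  ultimately have "(0, 0) \<in> G" unfolding G_def by force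
  then have z: "0 \<in> convex hull G" by (simp add: hull_inc zero_prod_def)
  show ?thesis
  proof (cases "x = 0")
    case False
    then have "x \<in> open_segment 0 (2 *\<^sub>R x)"
      unfolding in_segment by (intro conjI exI[of _ "1/2"]) auto
    then show ?thesis using F x z x2 unfolding K face_of_def by blast
  qed (use x in simp)
qed

end

theory Submission
  imports Defs
begin

text \<open>
  Write \<open>\<omega>\<^sub>j = (1, \<dots>, 1, 0, \<dots>, 0)\<close> with \<open>j\<close> ones, \<open>a = \<lambda>\<^sub>1\<close>, \<open>b = \<mu>\<^sub>1\<close> and \<open>r = a + 1\<close>.
  In the three cases the Hilbert basis element is
  (i) \<open>(a \<omega>\<^sub>b, b \<omega>\<^sub>a)\<close>,
  (ii) \<open>(a \<omega>\<^sub>b, \<omega>\<^bsub>a+1-b\<^esub> + (b-1) \<omega>\<^bsub>a+1\<^esub>)\<close>,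
  (iii) \<open>((a-1) \<omega>\<^bsub>b+1\<^esub> + \<omega>\<^bsub>2b+1-a\<^esub>, b \<omega>\<^bsub>a+1\<^esub>)\<close>.
  Only three fundamental weights occur in each, so prescribing where the two partitions may descend
  cuts out a face of dimension at most \<open>2\<close>, as the two sizes agree; a second, independent
  point on it is \<open>(r \<omega>\<^sub>j, j \<omega>\<^sub>r)\<close> with \<open>j = b\<close> or \<open>j = b + 1\<close>. In a decomposition
  both summands lie on this face. In (ii) and (iii) one of the coefficients is \<open>1\<close>, so one
  summand omits that weight and is \<open>(x \<omega>\<^sub>j, v \<omega>\<^sub>r)\<close> with \<open>x j = v r\<close> and \<open>x < r\<close>, which vanishes
  by coprimality; (i) is similar.
\<close>

section \<open>Fundamental weights and descents\<close>

abbreviation entry :: "('a \<Rightarrow>\<^sub>0 'b::zero) \<Rightarrow> 'a \<Rightarrow> 'b" where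
  "entry \<equiv> Poly_Mapping.lookup"

lemma entry_scaleR [simp]: "entry (c *\<^sub>R p) i = c * entry p i" for p :: rvec
  by (auto simp: scaleR_poly_mapping_def lookup_Abs_poly_mapping)

definition fundamental_weight :: "nat \<Rightarrow> rvec" where
  "fundamental_weight j = (\<Sum>i=1..j. Poly_Mapping.single i 1)"

lemma entry_fundamental_weight [simp]:
  "entry (fundamental_weight j) i = (if 1 \<le> i \<and> i \<le> j then 1 else 0)"
proof -
  have "entry (fundamental_weight j) i = (\<Sum>n=1..j. if n = i then 1 else 0)"
    by (simp add: fundamental_weight_def lookup_sum lookup_single when_def)
  then show ?thesis by simp
qed

lemma sum_fundamental_weight:
  assumes "j \<le> r"
  shows "(\<Sum>i=1..r. entry (fundamental_weight j) i) = real j"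
proof -
  have "(\<Sum>i=1..r. entry (fundamental_weight j) i) = (\<Sum>i=1..j. 1)"
    by (rule sum.mono_neutral_cong_right) (use assms in auto)
  then show ?thesis by simp
qed

text \<open>For a vector supported on 1..r this is the coefficient of omega_i in its expansion into
  fundamental weights. At \<open>i = r\<close> it equals the last entry, because the entry at
  \<open>Suc r\<close> vanishes.\<close>

definition drop_at :: "rvec \<Rightarrow> nat \<Rightarrow> real" where
  "drop_at p i = entry p i - entry p (Suc i)"

lemma drop_at_add: "drop_at (p + q) i = drop_at p i + drop_at q i"
  and drop_at_scaleR: "drop_at (c *\<^sub>R p) i = c * drop_at p i"
  and drop_at_zero [simp]: "drop_at 0 i = 0"
  by (simp_all add: drop_at_def lookup_add algebra_simps)

lemma drop_at_sum: "drop_at (\<Sum>j\<in>A. f j) i = (\<Sum>j\<in>A. drop_at (f j) i)"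
  by (simp add: drop_at_def lookup_sum sum_subtractf)

lemma drop_at_fundamental_weight:
  "1 \<le> i \<Longrightarrow> drop_at (fundamental_weight j) i = (if i = j then 1 else 0)"
  by (auto simp: drop_at_def)

text \<open>Abel summation: an entry is the sum of all descents from its position on. The set
  \<open>A\<close> lets the expansion be restricted to the few weights that occur on a face.\<close>

lemma rvec_eq_sum_fundamental_weights:
  assumes supp: "\<And>i. i \<notin> {1..r} \<Longrightarrow> entry p i = 0"
    and A: "A \<subseteq> {1..r}" and flat: "\<And>i. 1 \<le> i \<Longrightarrow> i \<notin> A \<Longrightarrow> drop_at p i = 0"
  shows "p = (\<Sum>j\<in>A. drop_at p j *\<^sub>R fundamental_weight j)"
proof (rule poly_mapping_eqI)
  fix i
  have "(\<Sum>j\<in>A. drop_at p j * entry (fundamental_weight j) i)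
      = (\<Sum>j=1..r. drop_at p j * entry (fundamental_weight j) i)"
    by (rule sum.mono_neutral_left) (use A flat in auto)
  also have "\<dots> = entry p i"
  proof (cases "i \<in> {1..r}")
    case True
    have "(\<Sum>j=1..r. drop_at p j * entry (fundamental_weight j) i) = (\<Sum>j=i..r. drop_at p j)"
      by (rule sum.mono_neutral_cong_right) (use True in auto)
    also have "\<dots> = - (\<Sum>j=i..r. entry p (Suc j) - entry p j)"
      by (simp add: drop_at_def sum_negf [symmetric])
    \<comment> \<open>The sum telescopes to \<open>entry p i - entry p (Suc r)\<close>, and
      \<open>Suc r\<close> lies outside the support.\<close>
    also have "\<dots> = entry p i"
      using True supp[of "Suc r"] by (subst sum_Suc_diff) auto
    finally show ?thesis .
  next
    case False
    then show ?thesis by (subst supp) (auto intro!: sum.neutral)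
  qed
  finally show "entry p i = entry (\<Sum>j\<in>A. drop_at p j *\<^sub>R fundamental_weight j) i"
    by (simp add: lookup_sum)
qed

section \<open>Inequalities for the Kostka cone and its integer points\<close>

text \<open>A description by inequalities, against which membership can be tested directly, unlike a
  convex hull. Descents are tested at every positive index, so the one at \<open>r\<close> makes the
  last entry nonnegative.\<close>

definition dominance_cone :: "nat \<Rightarrow> (rvec \<times> rvec) set" where
  "dominance_cone r = {(p, q).
     (\<forall>i. i \<notin> {1..r} \<longrightarrow> entry p i = 0 \<and> entry q i = 0) \<and>
     (\<forall>i\<ge>1. 0 \<le> drop_at p i \<and> 0 \<le> drop_at q i) \<and>
     (\<forall>k\<le>r. (\<Sum>i=1..k. entry q i) \<le> (\<Sum>i=1..k. entry p i)) \<and>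
     (\<Sum>i=1..r. entry p i) = (\<Sum>i=1..r. entry q i)}"

lemma dominance_cone_add:
  "x \<in> dominance_cone r \<Longrightarrow> y \<in> dominance_cone r \<Longrightarrow> x + y \<in> dominance_cone r"
  by (force simp: dominance_cone_def drop_at_add lookup_add sum.distrib intro!: add_mono)

lemma dominance_cone_scaleR:
  "x \<in> dominance_cone r \<Longrightarrow> 0 \<le> c \<Longrightarrow> c *\<^sub>R x \<in> dominance_cone r"
  by (auto simp: dominance_cone_def drop_at_scaleR sum_distrib_left [symmetric]
      intro!: mult_left_mono)

lemma convex_dominance_cone: "convex (dominance_cone r)"
  by (auto intro!: convexI dominance_cone_add dominance_cone_scaleR)

lemma entry_map_real [simp]: "entry (Poly_Mapping.map real l) i = real (entry l i)"
  by (simp add: map.rep_eq when_def)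

lemma kostka_cone_subset_dominance_cone: "kostka_cone r \<subseteq> dominance_cone r"
  unfolding kostka_cone_def
proof (rule hull_minimal)
  have supp: "entry l i = 0" if "l \<in> Par r n" "i \<notin> {1..r}" for l n i
    using that by (auto simp: Par_def in_keys_iff)
  have drop: "entry l (Suc i) \<le> entry l i" if "l \<in> Par r n" "1 \<le> i" for l n i
  proof (cases "i < r")
    case True
    then show ?thesis using that by (auto simp: Par_def)
  next
    case False
    \<comment> \<open>Here \<open>Suc i\<close> exceeds \<open>r\<close>, so the next entry is 0;
      this settles the boundary index \<open>i = r\<close>.\<close>
    then show ?thesis using supp[OF that(1), of "Suc i"] by auto
  qed
  show "{(Poly_Mapping.map real l, Poly_Mapping.map real m) | l m n.
      l \<in> Par r n \<and> m \<in> Par r n \<and> dominates r l m} \<subseteq> dominance_cone r"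
  proof clarify
    fix l m n
    assume lm: "l \<in> Par r n" "m \<in> Par r n" "dominates r l m"
    have "(\<Sum>i=1..r. entry l i) = (\<Sum>i=1..r. entry m i)"
      using lm by (auto simp: Par_def)
    moreover have "\<forall>k\<le>r. (\<Sum>i=1..k. entry m i) \<le> (\<Sum>i=1..k. entry l i)"
      using lm by (auto simp: dominates_def)
    ultimately show "(Poly_Mapping.map real l, Poly_Mapping.map real m) \<in> dominance_cone r"
      using supp[OF lm(1)] supp[OF lm(2)] drop[OF lm(1)] drop[OF lm(2)]
      by (auto simp: dominance_cone_def drop_at_def of_nat_sum [symmetric] simp del: of_nat_sum)
  qed
qed (rule convex_dominance_cone)

text \<open>The descents are the coefficients in the expansion into fundamental weights, whose
  entries are 0 or 1.\<close>

lemma antimono_entries_nonneg: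
  assumes "\<And>i. i \<notin> {1..r} \<Longrightarrow> entry p i = 0" and "\<And>i. 1 \<le> i \<Longrightarrow> 0 \<le> drop_at p i"
  shows "0 \<le> entry p i"
proof (cases "i \<in> {1..r}")
  case True
  have "p = (\<Sum>j\<in>{1..r}. drop_at p j *\<^sub>R fundamental_weight j)"
    by (rule rvec_eq_sum_fundamental_weights) (use assms in \<open>auto simp: drop_at_def\<close>)
  then have "entry p i = (\<Sum>j\<in>{1..r}. drop_at p j * entry (fundamental_weight j) i)"
    by (metis (no_types, lifting) lookup_sum entry_scaleR sum.cong)
  also have "\<dots> \<ge> 0"
    using assms(2) by (auto intro!: sum_nonneg)
  finally show ?thesis .
qed (use assms in auto)

text \<open>An integer point satisfying the inequalities is itself one of the generating pairs, so
  no convex combination has to be found. Together with the inclusion above, this identifies the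
  integer points of both cones, and the Hilbert basis depends on nothing else.\<close>

lemma integral_dominance_cone_in_kostka_cone:
  assumes x: "(p, q) \<in> dominance_cone r"
    and int: "\<And>i. entry p i \<in> \<int>" "\<And>i. entry q i \<in> \<int>"
  shows "(p, q) \<in> kostka_cone r"
proof -
  \<comment> \<open>The coercion is faithful only on nonnegative integers; nonnegativity of the
    entries comes from the descents.\<close>
  define N where "N p = Poly_Mapping.map (\<lambda>t::real. nat \<lfloor>t\<rfloor>) p" for p :: rvec
  have supp: "entry p i = 0" "entry q i = 0" if "i \<notin> {1..r}" for i
    using x that by (auto simp: dominance_cone_def)
  have drop: "0 \<le> drop_at p i" "0 \<le> drop_at q i" if "1 \<le> i" for i
    using x that by (auto simp: dominance_cone_def)
  have N: "real (entry (N p) i) = entry p i" if "0 \<le> entry p i" "entry p i \<in> \<int>" for p i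
    using that by (auto simp: N_def map.rep_eq when_def elim!: Ints_cases)
  have Np: "real (entry (N p) i) = entry p i" for i
    by (rule N) (use antimono_entries_nonneg[OF supp(1) drop(1)] int in auto)
  have Nq: "real (entry (N q) i) = entry q i" for i
    by (rule N) (use antimono_entries_nonneg[OF supp(2) drop(2)] int in auto)
  have eq: "p = Poly_Mapping.map real (N p)" "q = Poly_Mapping.map real (N q)"
    by (auto intro!: poly_mapping_eqI simp: Np Nq)
  have tot: "real (\<Sum>i=1..r. entry (N p) i) = real (\<Sum>i=1..r. entry (N q) i)"
    using x by (simp add: Np Nq dominance_cone_def)
  have dom: "real (\<Sum>i=1..k. entry (N q) i) \<le> real (\<Sum>i=1..k. entry (N p) i)" if "k \<le> r" for k
    using x that by (simp add: Np Nq dominance_cone_def)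
  have keys: "Poly_Mapping.keys (N p) \<subseteq> {1..r}" "Poly_Mapping.keys (N q) \<subseteq> {1..r}"
    unfolding subset_iff in_keys_iff
    by (metis supp(1) Np of_nat_eq_0_iff, metis supp(2) Nq of_nat_eq_0_iff)
  have dec: "entry (N p) (Suc i) \<le> entry (N p) i" "entry (N q) (Suc i) \<le> entry (N q) i"
    if "1 \<le> i" for i
    using drop[OF that] unfolding drop_at_def Np [symmetric] Nq [symmetric] by simp_all
  have "N p \<in> Par r (\<Sum>i=1..r. entry (N p) i)" "N q \<in> Par r (\<Sum>i=1..r. entry (N p) i)"
    using keys dec tot by (auto simp: Par_def simp del: of_nat_sum)
  moreover have "dominates r (N p) (N q)"
    using dom by (auto simp: dominates_def simp del: of_nat_sum)
  ultimately show ?thesis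
    unfolding kostka_cone_def by (intro hull_inc) (use eq in blast)
qed

lemma integer_points_kostka_cone:
  "integer_points (kostka_cone r) = integer_points (dominance_cone r)"
  using kostka_cone_subset_dominance_cone[of r] integral_dominance_cone_in_kostka_cone[of _ _ r]
  by (auto simp: integer_points_def)

section \<open>A two-summand criterion for the Hilbert basis\<close>

lemma integer_points_kostka_cone_add:
  assumes "x \<in> integer_points (kostka_cone r)" "y \<in> integer_points (kostka_cone r)"
  shows "x + y \<in> integer_points (kostka_cone r)"
  using assms unfolding integer_points_kostka_cone
  by (auto simp: integer_points_def lookup_add intro: dominance_cone_add)

lemma zero_in_integer_points_kostka_cone: "0 \<in> integer_points (kostka_cone r)"
  unfolding integer_points_kostka_cone
  by (auto simp: integer_points_def dominance_cone_def zero_prod_def)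

text \<open>Integer points of the cone are closed under addition, so from any nonnegative integer
  combination one copy of a generator can be split off, and what remains is again an integer point.
  Hence only sums of two integer points need to be excluded.\<close>

lemma hilbert_basis_kostka_coneI:
  assumes x: "x \<in> integer_points (kostka_cone r)" "x \<noteq> 0"
    and irred: "\<And>y z. y \<in> integer_points (kostka_cone r) \<Longrightarrow> z \<in> integer_points (kostka_cone r)
      \<Longrightarrow> x = y + z \<Longrightarrow> y = 0 \<or> z = 0"
  shows "x \<in> hilbert_basis (kostka_cone r)"
proof -
  let ?I = "integer_points (kostka_cone r)"
  have scale: "real n *\<^sub>R v \<in> ?I" if "v \<in> ?I" for n v
    using that by (induction n)
      (auto simp: scaleR_left_distrib zero_in_integer_points_kostka_cone
        intro: integer_points_kostka_cone_add)
  have comb: "(\<Sum>v\<in>A. real (c v) *\<^sub>R v) \<in> ?I" if "finite A" "A \<subseteq> ?I" for A c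
    using that by (induction A rule: finite_induct)
      (auto simp: zero_in_integer_points_kostka_cone intro!: integer_points_kostka_cone_add scale)
  have False if A: "finite A" "A \<subseteq> ?I - {x}" and xA: "x = (\<Sum>v\<in>A. real (c v) *\<^sub>R v)" for A c
  proof -
    obtain v where v: "v \<in> A" "real (c v) *\<^sub>R v \<noteq> 0"
      using x(2) xA by (metis (no_types, lifting) sum.neutral)
    then obtain n where n: "c v = Suc n" by (cases "c v") auto
    define w where "w = real n *\<^sub>R v + (\<Sum>v\<in>A - {v}. real (c v) *\<^sub>R v)"
    have "x = real (c v) *\<^sub>R v + (\<Sum>v\<in>A - {v}. real (c v) *\<^sub>R v)"
      unfolding xA by (rule sum.remove[OF A(1) v(1)])
    then have "x = v + w"
      by (simp add: w_def n scaleR_left_distrib)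
    moreover have "v \<in> ?I" using v A by auto
    moreover have "w \<in> ?I" unfolding w_def
      using A v by (intro integer_points_kostka_cone_add scale comb) auto
    \<comment> \<open>\<open>v = 0\<close> contradicts the choice of a nonzero term, and
      \<open>w = 0\<close> gives \<open>v = x\<close>, although \<open>A\<close> avoids
      \<open>x\<close>.\<close>
    ultimately have "v = 0 \<or> w = 0" using irred by blast
    then show False using v A \<open>x = v + w\<close> by auto
  qed
  then show ?thesis
    using x(1) unfolding hilbert_basis_def nonneg_int_combinations_def by blast
qed

section \<open>Faces given by prescribed descent positions\<close>

text \<open>Only the walls \<open>drop_at = 0\<close> cut out these faces, not the dominance
  inequalities. So \<open>A\<close> and \<open>B\<close> say which fundamental weights may occur in
  the two partitions.\<close>

definition kostka_face :: "nat \<Rightarrow> nat set \<Rightarrow> nat set \<Rightarrow> (rvec \<times> rvec) set" where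
  "kostka_face r A B = {(p, q) \<in> kostka_cone r.
     \<forall>i\<ge>1. (i \<notin> A \<longrightarrow> drop_at p i = 0) \<and> (i \<notin> B \<longrightarrow> drop_at q i = 0)}"

lemma kostka_cone_drop_at_nonneg:
  assumes "(p, q) \<in> kostka_cone r" "1 \<le> i"
  shows "0 \<le> drop_at p i" "0 \<le> drop_at q i"
  using assms kostka_cone_subset_dominance_cone[of r] by (auto simp: dominance_cone_def)

text \<open>Each descent is a linear functional that is nonnegative on the cone. If it vanishes at
  an interior point of a segment in the cone, it vanishes at both ends.\<close>

lemma kostka_face_face_of: "kostka_face r A B face_of kostka_cone r"
  unfolding face_of_def
proof (intro conjI ballI impI)
  show "kostka_face r A B \<subseteq> kostka_cone r" by (auto simp: kostka_face_def)
  have "convex (kostka_cone r)" by (simp add: kostka_cone_def)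
  then show "convex (kostka_face r A B)"
    by (auto simp: convex_def kostka_face_def drop_at_add drop_at_scaleR)
      (metis (no_types, lifting) scaleR_Pair add_Pair)
next
  have zero: "s = 0 \<and> t = 0"
    if "0 < u" "u < 1" "(1 - u) * s + u * t = 0" "0 \<le> s" "0 \<le> t" for s t u :: real
    using that by (smt (verit) mult_pos_pos mult_nonneg_nonneg)
  fix a b x
  assume ab: "a \<in> kostka_cone r" "b \<in> kostka_cone r"
    and x: "x \<in> kostka_face r A B" "x \<in> open_segment a b"
  obtain a1 a2 b1 b2 where [simp]: "a = (a1, a2)" "b = (b1, b2)" by (cases a, cases b) auto
  obtain u where u: "0 < u" "u < 1" "x = (1 - u) *\<^sub>R a + u *\<^sub>R b"
    using x(2) by (auto simp: in_segment)
  have "drop_at a1 i = 0 \<and> drop_at b1 i = 0" if "1 \<le> i" "i \<notin> A" for i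
    using x(1) u that ab kostka_cone_drop_at_nonneg[of _ _ r i]
    by (intro zero[of u]) (auto simp: kostka_face_def drop_at_add drop_at_scaleR)
  moreover have "drop_at a2 i = 0 \<and> drop_at b2 i = 0" if "1 \<le> i" "i \<notin> B" for i
    using x(1) u that ab kostka_cone_drop_at_nonneg[of _ _ r i]
    by (intro zero[of u]) (auto simp: kostka_face_def drop_at_add drop_at_scaleR)
  ultimately show "a \<in> kostka_face r A B" "b \<in> kostka_face r A B"
    using ab by (auto simp: kostka_face_def)
qed

section \<open>Integral combinations of fundamental weights\<close>

text \<open>Up to the crossing \<open>c\<close> the sums compare termwise. Beyond it the tails
  compare the other way, and equality of the totals turns this into the claim. This gives dominance
  for all pairs constructed below.\<close>

lemma partial_sums_le_if_single_crossing:
  fixes f g :: "nat \<Rightarrow> real"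
  assumes tot: "(\<Sum>i=1..r. f i) = (\<Sum>i=1..r. g i)"
    and before: "\<And>i. 1 \<le> i \<Longrightarrow> i \<le> c \<Longrightarrow> g i \<le> f i"
    and after: "\<And>i. c < i \<Longrightarrow> i \<le> r \<Longrightarrow> f i \<le> g i"
    and "k \<le> r"
  shows "(\<Sum>i=1..k. g i) \<le> (\<Sum>i=1..k. f i)"
proof (cases "k \<le> c")
  case True
  then show ?thesis by (intro sum_mono before) auto
next
  case False
  have split: "(\<Sum>i=1..r. h i) = (\<Sum>i=1..k. h i) + (\<Sum>i=k+1..r. h i)" for h :: "nat \<Rightarrow> real"
    using \<open>k \<le> r\<close> by (metis Suc_eq_plus1 le_add2 le_add_diff_inverse sum.ub_add_nat)
  have "(\<Sum>i=k+1..r. f i) \<le> (\<Sum>i=k+1..r. g i)"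
    by (intro sum_mono after) (use False in auto)
  then show ?thesis using tot split[of f] split[of g] by linarith
qed

text \<open>Natural coefficients make the entries integral, and they can be read back as
  descents.\<close>

definition weight_comb :: "nat set \<Rightarrow> (nat \<Rightarrow> nat) \<Rightarrow> rvec" where
  "weight_comb A f = (\<Sum>j\<in>A. real (f j) *\<^sub>R fundamental_weight j)"

lemma entry_weight_comb:
  "entry (weight_comb A f) i = (\<Sum>j\<in>A. real (f j) * entry (fundamental_weight j) i)"
  by (simp add: weight_comb_def lookup_sum)

lemma drop_at_weight_comb:
  "finite A \<Longrightarrow> 1 \<le> i \<Longrightarrow> drop_at (weight_comb A f) i = (if i \<in> A then real (f i) else 0)"
  by (simp add: weight_comb_def drop_at_sum drop_at_scaleR drop_at_fundamental_weight
      if_distrib cong: if_cong)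

lemma sum_entry_weight_comb:
  assumes "A \<subseteq> {1..r}"
  shows "(\<Sum>i=1..r. entry (weight_comb A f) i) = real (\<Sum>j\<in>A. f j * j)"
proof -
  have "(\<Sum>i=1..r. entry (weight_comb A f) i)
      = (\<Sum>j\<in>A. real (f j) * (\<Sum>i=1..r. entry (fundamental_weight j) i))"
    unfolding entry_weight_comb by (subst sum.swap) (simp add: sum_distrib_left)
  also have "\<dots> = (\<Sum>j\<in>A. real (f j) * real j)"
    by (intro sum.cong refl) (use assms in \<open>subst sum_fundamental_weight, auto\<close>)
  finally show ?thesis by simp
qed

lemma weight_comb_in_integer_points:
  assumes A: "A \<subseteq> {1..r}" and B: "B \<subseteq> {1..r}"
    and tot: "(\<Sum>j\<in>A. f j * j) = (\<Sum>k\<in>B. g k * k)"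
    and before: "\<And>i. 1 \<le> i \<Longrightarrow> i \<le> c \<Longrightarrow> entry (weight_comb B g) i \<le> entry (weight_comb A f) i"
    and after: "\<And>i. c < i \<Longrightarrow> i \<le> r \<Longrightarrow> entry (weight_comb A f) i \<le> entry (weight_comb B g) i"
  shows "(weight_comb A f, weight_comb B g) \<in> integer_points (kostka_cone r)"
proof -
  have fin: "finite A" "finite B" using A B by (auto intro: finite_subset)
  have supp: "entry (weight_comb C h) i = 0" if "C \<subseteq> {1..r}" "i \<notin> {1..r}" for C h i
    using that by (auto simp: entry_weight_comb intro!: sum.neutral)
  have int: "entry (weight_comb C h) i \<in> \<int>" for C h i
    by (auto simp: entry_weight_comb intro!: Ints_sum)
  have eq: "(\<Sum>i=1..r. entry (weight_comb A f) i) = (\<Sum>i=1..r. entry (weight_comb B g) i)"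
    using A B tot by (simp only: sum_entry_weight_comb)
  show ?thesis
    unfolding integer_points_kostka_cone
    unfolding integer_points_def dominance_cone_def
    using supp[OF A] supp[OF B] fin eq partial_sums_le_if_single_crossing[OF eq before after]
    by (auto simp: int drop_at_weight_comb)
qed

lemma weight_comb_in_kostka_face:
  assumes "finite A" "finite B" "A' \<subseteq> A" "B' \<subseteq> B"
    and "(weight_comb A' f, weight_comb B' g) \<in> integer_points (kostka_cone r)"
  shows "(weight_comb A' f, weight_comb B' g) \<in> kostka_face r A B"
proof -
  have "finite A'" "finite B'" using assms by (auto intro: finite_subset)
  then show ?thesis
    using assms by (auto simp: kostka_face_def integer_points_def drop_at_weight_comb)
qed

text \<open>The last identity expresses that both partitions have the same size. It is a linear
  relation between the coefficients, so three permitted weights leave dimension at most two.\<close>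

lemma kostka_face_expansion:
  assumes A: "A \<subseteq> {1..r}" and B: "B \<subseteq> {1..r}" and x: "(p, q) \<in> kostka_face r A B"
  shows "p = (\<Sum>j\<in>A. drop_at p j *\<^sub>R fundamental_weight j)"
    and "q = (\<Sum>k\<in>B. drop_at q k *\<^sub>R fundamental_weight k)"
    and "(\<Sum>j\<in>A. drop_at p j * real j) = (\<Sum>k\<in>B. drop_at q k * real k)"
proof -
  have dom: "(p, q) \<in> dominance_cone r"
    using x kostka_cone_subset_dominance_cone by (auto simp: kostka_face_def)
  show p: "p = (\<Sum>j\<in>A. drop_at p j *\<^sub>R fundamental_weight j)"
    by (rule rvec_eq_sum_fundamental_weights[of r])
      (use A x dom in \<open>auto simp: dominance_cone_def kostka_face_def\<close>)
  show q: "q = (\<Sum>k\<in>B. drop_at q k *\<^sub>R fundamental_weight k)"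
    by (rule rvec_eq_sum_fundamental_weights[of r])
      (use B x dom in \<open>auto simp: dominance_cone_def kostka_face_def\<close>)
  have tot: "(\<Sum>i=1..r. entry s i) = (\<Sum>j\<in>C. drop_at s j * real j)"
    if "C \<subseteq> {1..r}" "s = (\<Sum>j\<in>C. drop_at s j *\<^sub>R fundamental_weight j)" for s C
  proof -
    have "(\<Sum>i=1..r. entry s i)
        = (\<Sum>i=1..r. \<Sum>j\<in>C. drop_at s j * entry (fundamental_weight j) i)"
      by (subst that(2)) (simp add: lookup_sum)
    also have "\<dots> = (\<Sum>j\<in>C. drop_at s j * (\<Sum>i=1..r. entry (fundamental_weight j) i))"
      by (subst sum.swap) (simp only: sum_distrib_left)
    also have "\<dots> = (\<Sum>j\<in>C. drop_at s j * real j)"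
      by (intro sum.cong refl) (use that(1) in \<open>subst sum_fundamental_weight, auto\<close>)
    finally show ?thesis .
  qed
  show "(\<Sum>j\<in>A. drop_at p j * real j) = (\<Sum>k\<in>B. drop_at q k * real k)"
    using dom tot[OF A p] tot[OF B q] by (simp add: dominance_cone_def)
qed

text \<open>Both summands of a point of the face lie on the face again, so decompositions are governed
  by the coefficients of the fundamental weights alone.\<close>

lemma weight_comb_in_hilbert_basis:
  assumes A: "A \<subseteq> {1..r}" and B: "B \<subseteq> {1..r}"
    and x: "(weight_comb A f, weight_comb B g) \<in> integer_points (kostka_cone r)"
    and j: "j \<in> A" "f j \<noteq> 0"
    and irred: "\<And>f' g'. \<lbrakk>\<forall>j\<in>A. f' j \<le> f j; \<forall>k\<in>B. g' k \<le> g k;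
        (\<Sum>j\<in>A. f' j * j) = (\<Sum>k\<in>B. g' k * k)\<rbrakk>
      \<Longrightarrow> (\<forall>j\<in>A. f' j = 0) \<and> (\<forall>k\<in>B. g' k = 0) \<or> (\<forall>j\<in>A. f' j = f j) \<and> (\<forall>k\<in>B. g' k = g k)"
  shows "(weight_comb A f, weight_comb B g) \<in> hilbert_basis (kostka_cone r)"
proof (rule hilbert_basis_kostka_coneI)
  have fin: "finite A" "finite B" using A B by (auto intro: finite_subset)
  show "(weight_comb A f, weight_comb B g) \<in> integer_points (kostka_cone r)" by fact
  have "drop_at (weight_comb A f) j \<noteq> 0"
    using j A fin by (subst drop_at_weight_comb) auto
  then show "(weight_comb A f, weight_comb B g) \<noteq> 0" by (auto simp: zero_prod_def)
  fix y z
  assume y: "y \<in> integer_points (kostka_cone r)" and z: "z \<in> integer_points (kostka_cone r)"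
    and sum: "(weight_comb A f, weight_comb B g) = y + z"
  obtain p q p' q' where [simp]: "y = (p, q)" "z = (p', q')" by (cases y, cases z) auto
  have add: "drop_at p i + drop_at p' i = drop_at (weight_comb A f) i"
    "drop_at q i + drop_at q' i = drop_at (weight_comb B g) i" for i
    using sum by (auto simp: drop_at_add)
  have nonneg: "0 \<le> drop_at p i" "0 \<le> drop_at p' i" "0 \<le> drop_at q i" "0 \<le> drop_at q' i"
    if "1 \<le> i" for i
    using y z that kostka_cone_drop_at_nonneg[of _ _ r i] by (auto simp: integer_points_def)
  have int: "drop_at p i \<in> \<int>" "drop_at q i \<in> \<int>" for i
    using y by (auto simp: integer_points_def drop_at_def)
  \<comment> \<open>The descents of \<open>y\<close> are nonnegative integers, so the floors lose
    nothing and supply natural coefficients for \<open>irred\<close>.\<close>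
  define f' where "f' i = nat \<lfloor>drop_at p i\<rfloor>" for i
  define g' where "g' i = nat \<lfloor>drop_at q i\<rfloor>" for i
  have f': "real (f' i) = drop_at p i" and g': "real (g' i) = drop_at q i" if "1 \<le> i" for i
    using int[of i] nonneg[OF that] by (auto simp: f'_def g'_def elim!: Ints_cases)
  have "drop_at p i = 0" if "1 \<le> i" "i \<notin> A" for i
    using add(1)[of i] nonneg[of i] that fin by (auto simp: drop_at_weight_comb)
  moreover have "drop_at q i = 0" if "1 \<le> i" "i \<notin> B" for i
    using add(2)[of i] nonneg[of i] that fin by (auto simp: drop_at_weight_comb)
  ultimately have "(p, q) \<in> kostka_face r A B"
    using y by (auto simp: kostka_face_def integer_points_def)
  note expand = kostka_face_expansion[OF A B this]
  have pw: "p = weight_comb A f'"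
    unfolding weight_comb_def
    by (subst expand(1), rule sum.cong) (use A f' in auto)
  have qw: "q = weight_comb B g'"
    unfolding weight_comb_def
    by (subst expand(2), rule sum.cong) (use B g' in auto)
  have "real (f' i) \<le> real (f i)" if "i \<in> A" for i
  proof -
    have "1 \<le> i" using that A by auto
    then show ?thesis
      using add(1)[of i] nonneg[of i] f'[of i] that fin by (simp add: drop_at_weight_comb)
  qed
  moreover have "real (g' i) \<le> real (g i)" if "i \<in> B" for i
  proof -
    have "1 \<le> i" using that B by auto
    then show ?thesis
      using add(2)[of i] nonneg[of i] g'[of i] that fin by (simp add: drop_at_weight_comb)
  qed
  moreover have "real (\<Sum>j\<in>A. f' j * j) = real (\<Sum>k\<in>B. g' k * k)"
  proof -
    have "real (\<Sum>j\<in>A. f' j * j) = (\<Sum>j\<in>A. drop_at p j * real j)"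
      using A f' by (auto intro!: sum.cong)
    also have "\<dots> = (\<Sum>k\<in>B. drop_at q k * real k)" by (rule expand(3))
    also have "\<dots> = real (\<Sum>k\<in>B. g' k * k)"
      using B g' by (auto intro!: sum.cong)
    finally show ?thesis .
  qed
  ultimately consider "\<forall>j\<in>A. f' j = 0" "\<forall>k\<in>B. g' k = 0" | "\<forall>j\<in>A. f' j = f j" "\<forall>k\<in>B. g' k = g k"
    using irred[of f' g'] by (auto simp del: of_nat_sum)
  then show "y = 0 \<or> z = 0"
  proof cases
    case 1
    then show ?thesis by (simp add: pw qw weight_comb_def zero_prod_def)
  next
    case 2
    then have "y = (weight_comb A f, weight_comb B g)"
      by (simp add: pw qw weight_comb_def)
    then show ?thesis using sum by (simp add: zero_prod_def)
  qed
qed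

section \<open>Two families of Hilbert basis elements on 2-dimensional faces\<close>

lemma dim_eq_2I:
  fixes x y :: "'a::real_vector"
  assumes "F \<subseteq> span {x, y}" "x \<in> F" "y \<in> F" "x \<notin> span {y}" "y \<noteq> 0"
  shows "dim F = 2"
proof -
  have "span {x, y} = span F"
    using assms by (intro subset_antisym span_minimal) (auto intro: span_base)
  moreover have "independent {x, y}"
    by (intro independent_insertI independent_empty) (use assms in auto)
  moreover have "card {x, y} = 2"
    using assms(4) by (auto simp: card_2_iff intro: span_base)
  ultimately show ?thesis by (metis dim_eq_card)
qed

lemma rectangle_pair_in_integer_points:
  assumes "0 < j" "j < r"
  shows "(weight_comb {j} (\<lambda>_. r), weight_comb {r} (\<lambda>_. j)) \<in> integer_points (kostka_cone r)"
  by (rule weight_comb_in_integer_points[where c = j])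
    (use assms in \<open>auto simp: entry_weight_comb\<close>)

text \<open>This serves cases (i) and (ii). The pair crosses at \<open>j\<close>: up to there the
  first partition has entries \<open>s\<close>, at least \<open>u + v\<close>, and afterwards it is
  zero. Irreducibility is left as the purely arithmetical hypothesis \<open>irred\<close>.\<close>

lemma rectangle_and_two_weights_in_hilbert_basis:
  fixes j k r s u v :: nat
  assumes jk: "0 < j" "j < r" "0 < k" "k < r" and u: "0 < u" "u + v \<le> s"
    and tot: "s * j = u * k + v * r"
    and irred: "\<And>x u' v'. \<lbrakk>x \<le> s; u' \<le> u; v' \<le> v; x * j = u' * k + v' * r\<rbrakk>
      \<Longrightarrow> x = 0 \<and> u' = 0 \<and> v' = 0 \<or> x = s \<and> u' = u \<and> v' = v"
  shows "\<exists>(l, m) \<in> hilbert_basis (kostka_cone r). entry l 1 = real s \<and> entry m 1 = real (u + v) \<and>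
    (\<exists>F. F face_of kostka_cone r \<and> dim F = 2 \<and> (l, m) \<in> F)"
proof -
  define l where "l = weight_comb {j} (\<lambda>_. s)"
  define m where "m = weight_comb {k, r} (\<lambda>i. if i = k then u else v)"
  define e where "e = (weight_comb {j} (\<lambda>_. r), weight_comb {r} (\<lambda>_. j))"
  let ?F = "kostka_face r {j} {k, r}"
  have int: "(l, m) \<in> integer_points (kostka_cone r)"
    unfolding l_def m_def
    by (rule weight_comb_in_integer_points[where c = j])
      (use jk u tot in \<open>auto simp: entry_weight_comb\<close>)
  have hb: "(l, m) \<in> hilbert_basis (kostka_cone r)"
    unfolding l_def m_def
  proof (rule weight_comb_in_hilbert_basis)
    fix f' g' :: "nat \<Rightarrow> nat"
    assume "\<forall>i\<in>{j}. f' i \<le> s" "\<forall>i\<in>{k, r}. g' i \<le> (if i = k then u else v)"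
      "(\<Sum>i\<in>{j}. f' i * i) = (\<Sum>i\<in>{k, r}. g' i * i)"
    then show "(\<forall>i\<in>{j}. f' i = 0) \<and> (\<forall>i\<in>{k, r}. g' i = 0) \<or>
        (\<forall>i\<in>{j}. f' i = s) \<and> (\<forall>i\<in>{k, r}. g' i = (if i = k then u else v))"
      using irred[of "f' j" "g' k" "g' r"] jk by auto
  qed (use jk u int in \<open>auto simp: l_def m_def\<close>)
  have F: "(l, m) \<in> ?F" "e \<in> ?F"
    unfolding l_def m_def e_def
    by (rule weight_comb_in_kostka_face;
        use int rectangle_pair_in_integer_points[OF jk(1,2)] in \<open>auto simp: l_def m_def\<close>)+
  have "dim ?F = 2"
  proof (rule dim_eq_2I[OF _ F])
    show "?F \<subseteq> span {(l, m), e}"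
    proof clarify
      fix p q assume pq: "(p, q) \<in> ?F"
      \<comment> \<open>Of the two spanning vectors only \<open>(l, m)\<close> contains omega_k, so
        this weight fixes \<open>c\<close>; then omega_r fixes \<open>t\<close>. The coefficient of
        omega_j is forced by equality of sizes.\<close>
      define c where "c = drop_at q k / real u"
      define t where "t = (drop_at q r - c * real v) / real j"
      note expand = kostka_face_expansion[OF _ _ pq]
      have uc: "drop_at q k = c * real u" using u by (simp add: c_def)
      have vt: "drop_at q r = c * real v + t * real j" using jk by (simp add: t_def)
      have "drop_at p j * real j = c * (real u * real k) + (c * real v + t * real j) * real r"
        using expand(3) jk by (simp add: uc vt)
      also have "\<dots> = c * real (u * k + v * r) + t * real j * real r"
        by (simp add: algebra_simps)
      also have "\<dots> = (c * real s + t * real r) * real j"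
        unfolding tot [symmetric] by (simp add: algebra_simps)
      finally have xt: "drop_at p j = c * real s + t * real r" using jk by simp
      have "p = c *\<^sub>R l + t *\<^sub>R fst e"
        using expand(1) jk by (simp add: xt l_def e_def weight_comb_def algebra_simps)
      moreover have "q = c *\<^sub>R m + t *\<^sub>R snd e"
        using expand(2) jk by (simp add: uc vt m_def e_def weight_comb_def algebra_simps)
      ultimately have "(p, q) = c *\<^sub>R (l, m) + t *\<^sub>R e"
        by (cases e) simp
      then show "(p, q) \<in> span {(l, m), e}"
        by (simp only:) (intro span_add span_scale span_base; simp)
    qed
    have "drop_at m k \<noteq> 0" "drop_at (snd e) k = 0"
      using jk u by (simp_all add: m_def e_def drop_at_weight_comb)
    then show "(l, m) \<notin> span {e}"
      by (cases e) (auto simp: span_singleton drop_at_scaleR)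
    have "drop_at (fst e) j \<noteq> 0"
      using jk by (simp add: e_def drop_at_weight_comb)
    then show "e \<noteq> 0" by (auto simp: zero_prod_def)
  qed
  moreover have "entry l 1 = real s" "entry m 1 = real (u + v)"
    using jk by (simp_all add: l_def m_def entry_weight_comb)
  ultimately show ?thesis using hb F(1) kostka_face_face_of by blast
qed

text \<open>The counterpart for case (iii), with two weights in the first partition. As
  \<open>k < j\<close>, its entries up to \<open>j\<close> are \<open>s + t\<close> or
  \<open>s\<close>, so \<open>v \<le> s\<close> again gives a crossing at \<open>j\<close>.\<close>

lemma two_weights_and_rectangle_in_hilbert_basis:
  fixes j k r s t v :: nat
  assumes jk: "0 < k" "k < j" "j < r" and t: "0 < t" "v \<le> s"
    and tot: "s * j + t * k = v * r"
    and irred: "\<And>x y v'. \<lbrakk>x \<le> s; y \<le> t; v' \<le> v; x * j + y * k = v' * r\<rbrakk>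
      \<Longrightarrow> x = 0 \<and> y = 0 \<and> v' = 0 \<or> x = s \<and> y = t \<and> v' = v"
  shows "\<exists>(l, m) \<in> hilbert_basis (kostka_cone r). entry l 1 = real (s + t) \<and> entry m 1 = real v \<and>
    (\<exists>F. F face_of kostka_cone r \<and> dim F = 2 \<and> (l, m) \<in> F)"
proof -
  define l where "l = weight_comb {j, k} (\<lambda>i. if i = k then t else s)"
  define m where "m = weight_comb {r} (\<lambda>_. v)"
  define e where "e = (weight_comb {j} (\<lambda>_. r), weight_comb {r} (\<lambda>_. j))"
  let ?F = "kostka_face r {j, k} {r}"
  have int: "(l, m) \<in> integer_points (kostka_cone r)"
    unfolding l_def m_def
    by (rule weight_comb_in_integer_points[where c = j])
      (use jk t tot in \<open>auto simp: entry_weight_comb\<close>)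
  have hb: "(l, m) \<in> hilbert_basis (kostka_cone r)"
    unfolding l_def m_def
  proof (rule weight_comb_in_hilbert_basis[where j = k])
    fix f' g' :: "nat \<Rightarrow> nat"
    assume "\<forall>i\<in>{j, k}. f' i \<le> (if i = k then t else s)" "\<forall>i\<in>{r}. g' i \<le> v"
      "(\<Sum>i\<in>{j, k}. f' i * i) = (\<Sum>i\<in>{r}. g' i * i)"
    then show "(\<forall>i\<in>{j, k}. f' i = 0) \<and> (\<forall>i\<in>{r}. g' i = 0) \<or>
        (\<forall>i\<in>{j, k}. f' i = (if i = k then t else s)) \<and> (\<forall>i\<in>{r}. g' i = v)"
      using irred[of "f' j" "f' k" "g' r"] jk by auto
  qed (use jk t int in \<open>auto simp: l_def m_def\<close>)
  have F: "(l, m) \<in> ?F" "e \<in> ?F"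
    unfolding l_def m_def e_def
    by (rule weight_comb_in_kostka_face;
        use jk int rectangle_pair_in_integer_points[of j r] in \<open>auto simp: l_def m_def\<close>)+
  have "dim ?F = 2"
  proof (rule dim_eq_2I[OF _ F])
    show "?F \<subseteq> span {(l, m), e}"
    proof clarify
      fix p q assume pq: "(p, q) \<in> ?F"
      \<comment> \<open>Now omega_k occurs in the first component and fixes \<open>c\<close>,
        omega_j fixes \<open>d\<close>, and equality of sizes forces the coefficient of
        omega_r.\<close>
      define c where "c = drop_at p k / real t"
      define d where "d = (drop_at p j - c * real s) / real r"
      note expand = kostka_face_expansion[OF _ _ pq]
      have tc: "drop_at p k = c * real t" using t by (simp add: c_def)
      have sd: "drop_at p j = c * real s + d * real r" using jk by (simp add: d_def)
      have "drop_at q r * real r = (c * real s + d * real r) * real j + c * (real t * real k)"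
        using expand(3) jk by (simp add: tc sd)
      also have "\<dots> = c * real (s * j + t * k) + d * real r * real j"
        by (simp add: algebra_simps)
      also have "\<dots> = (c * real v + d * real j) * real r"
        unfolding tot by (simp add: algebra_simps)
      finally have vd: "drop_at q r = c * real v + d * real j" using jk by simp
      have "p = c *\<^sub>R l + d *\<^sub>R fst e"
        using expand(1) jk by (simp add: tc sd l_def e_def weight_comb_def algebra_simps)
      moreover have "q = c *\<^sub>R m + d *\<^sub>R snd e"
        using expand(2) jk by (simp add: vd m_def e_def weight_comb_def algebra_simps)
      ultimately have "(p, q) = c *\<^sub>R (l, m) + d *\<^sub>R e"
        by (cases e) simp
      then show "(p, q) \<in> span {(l, m), e}"
        by (simp only:) (intro span_add span_scale span_base; simp)
    qed
    have "drop_at l k \<noteq> 0" "drop_at (fst e) k = 0"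
      using jk t by (simp_all add: l_def e_def drop_at_weight_comb)
    then show "(l, m) \<notin> span {e}"
      by (cases e) (auto simp: span_singleton drop_at_scaleR)
    have "drop_at (fst e) j \<noteq> 0"
      using jk by (simp add: e_def drop_at_weight_comb)
    then show "e \<noteq> 0" by (auto simp: zero_prod_def)
  qed
  moreover have "entry l 1 = real (s + t)" "entry m 1 = real v"
    using jk by (simp_all add: l_def m_def entry_weight_comb)
  ultimately show ?thesis using hb F(1) kostka_face_face_of by blast
qed

section \<open>Arithmetic of the three coprimality cases\<close>

lemma coprime_mult_eq_less_imp_zero:
  fixes r j x v :: nat
  assumes "coprime r j" "x * j = v * r" "x < r"
  shows "x = 0"
proof -
  have "r dvd x" using assms(1,2) by (metis coprime_dvd_mult_left_iff dvd_triv_right)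
  then show ?thesis using assms(3) by (auto dest: dvd_imp_le)
qed

lemma kostka_hilbert_basis_on_2_face:
  fixes l1 m1 :: nat
  assumes "0 < m1" and "m1 \<le> l1"
    and "coprime l1 m1 \<or> coprime (l1 + 1) m1 \<or> (coprime (l1 + 1) (m1 + 1) \<and> 2 * m1 \<ge> l1)"
  shows "\<exists>(l, m) \<in> hilbert_basis (kostka_cone (l1 + 1)).
       entry l 1 = real l1 \<and> entry m 1 = real m1 \<and>
       (\<exists>F. F face_of kostka_cone (l1 + 1) \<and> dim F = 2 \<and> (l, m) \<in> F)"
proof -
  consider (1) "coprime l1 m1" | (2) "coprime (l1 + 1) m1"
    | (3) "coprime (l1 + 1) (m1 + 1)" "2 * m1 \<ge> l1" using assms by blast
  then show ?thesis
  proof cases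
    case 1
    have "\<exists>(l, m) \<in> hilbert_basis (kostka_cone (l1 + 1)).
       entry l 1 = real l1 \<and> entry m 1 = real (m1 + 0) \<and>
       (\<exists>F. F face_of kostka_cone (l1 + 1) \<and> dim F = 2 \<and> (l, m) \<in> F)"
    proof (rule rectangle_and_two_weights_in_hilbert_basis[where j = m1 and k = l1])
      fix x u' v'
      assume h: "x \<le> l1" "v' \<le> 0" "x * m1 = u' * l1 + v' * (l1 + 1)"
      then have eq: "x * m1 = u' * l1" by simp
      show "x = 0 \<and> u' = 0 \<and> v' = 0 \<or> x = l1 \<and> u' = m1 \<and> v' = 0"
        using coprime_mult_eq_less_imp_zero[OF 1 eq] eq h assms by (cases "x = l1") auto
    qed (use assms in auto)
    then show ?thesis by simp
  next
    case 2
    have "\<exists>(l, m) \<in> hilbert_basis (kostka_cone (l1 + 1)).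
       entry l 1 = real l1 \<and> entry m 1 = real (1 + (m1 - 1)) \<and>
       (\<exists>F. F face_of kostka_cone (l1 + 1) \<and> dim F = 2 \<and> (l, m) \<in> F)"
    \<comment> \<open>The index \<open>k\<close> is what remains of the size:
      \<open>l1 * m1 = m1 * (l1 + 1) - m1\<close>, which is \<open>m1 - 1\<close> full columns of
      height \<open>l1 + 1\<close> and one of height \<open>l1 + 1 - m1\<close>.\<close>
    proof (rule rectangle_and_two_weights_in_hilbert_basis[where j = m1 and k = "l1 + 1 - m1"])
      show tot: "l1 * m1 = 1 * (l1 + 1 - m1) + (m1 - 1) * (l1 + 1)"
        using assms by (cases m1) (auto simp: algebra_simps)
      fix x u' v'
      assume h: "x \<le> l1" "u' \<le> 1" "v' \<le> m1 - 1"
        "x * m1 = u' * (l1 + 1 - m1) + v' * (l1 + 1)"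
      show "x = 0 \<and> u' = 0 \<and> v' = 0 \<or> x = l1 \<and> u' = 1 \<and> v' = m1 - 1"
      proof (cases "u' = 0")
        case True
        then show ?thesis
          using coprime_mult_eq_less_imp_zero[OF 2, of x v'] h by auto
      next
        case False
        then have "u' = 1" using h by simp
        \<comment> \<open>The complementary summand omits omega_k, so passing to it reduces to the
          case \<open>u' = 0\<close>.\<close>
        have "(l1 - x) * m1 = l1 * m1 - x * m1" by (rule diff_mult_distrib)
        also have "\<dots> = (m1 - 1) * (l1 + 1) - v' * (l1 + 1)"
          using tot h(4) \<open>u' = 1\<close> by (metis Nat.diff_cancel)
        also have "\<dots> = (m1 - 1 - v') * (l1 + 1)" by (rule diff_mult_distrib [symmetric])
        finally have eq: "(l1 - x) * m1 = (m1 - 1 - v') * (l1 + 1)" .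
        have "l1 - x = 0" by (rule coprime_mult_eq_less_imp_zero[OF 2 eq]) simp
        then show ?thesis using eq h(1-3) \<open>u' = 1\<close> by auto
      qed
    qed (use assms in auto)
    then show ?thesis using assms by simp
  next
    case 3
    \<comment> \<open>Equality would make \<open>l1 + 1\<close>, which is at least 2, coprime to
      itself.\<close>
    have "m1 < l1" using assms 3 by (cases "m1 = l1") auto
    have "\<exists>(l, m) \<in> hilbert_basis (kostka_cone (l1 + 1)).
       entry l 1 = real (l1 - 1 + 1) \<and> entry m 1 = real m1 \<and>
       (\<exists>F. F face_of kostka_cone (l1 + 1) \<and> dim F = 2 \<and> (l, m) \<in> F)"
    \<comment> \<open>The height \<open>k\<close> is the difference of \<open>m1 * (l1 + 1)\<close>
      and \<open>(l1 - 1) * (m1 + 1)\<close>. The hypothesis \<open>2 * m1 \<ge> l1\<close> makes it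
      positive, and \<open>m1 < l1\<close> gives \<open>k < j\<close> and
      \<open>v \<le> s\<close>.\<close>
    proof (rule two_weights_and_rectangle_in_hilbert_basis[where j = "m1 + 1" and k = "2 * m1 + 1 - l1"])
      show tot: "(l1 - 1) * (m1 + 1) + 1 * (2 * m1 + 1 - l1) = m1 * (l1 + 1)"
        using \<open>m1 < l1\<close> 3 by (cases l1) (auto simp: algebra_simps)
      fix x y v'
      assume h: "x \<le> l1 - 1" "y \<le> 1" "v' \<le> m1"
        "x * (m1 + 1) + y * (2 * m1 + 1 - l1) = v' * (l1 + 1)"
      show "x = 0 \<and> y = 0 \<and> v' = 0 \<or> x = l1 - 1 \<and> y = 1 \<and> v' = m1"
      proof (cases "y = 0")
        case True
        then have eq: "x * (m1 + 1) = v' * (l1 + 1)" using h by simp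
        have "x = 0"
          by (rule coprime_mult_eq_less_imp_zero[OF 3(1) eq]) (use h \<open>m1 < l1\<close> in simp)
        then show ?thesis using eq True by simp
      next
        case False
        then have "y = 1" using h by simp
        \<comment> \<open>Again the complementary summand omits omega_k and must vanish.\<close>
        have "(l1 - 1 - x) * (m1 + 1) = (l1 - 1) * (m1 + 1) - x * (m1 + 1)"
          by (rule diff_mult_distrib)
        also have "\<dots> = m1 * (l1 + 1) - v' * (l1 + 1)"
          using tot h(4) \<open>y = 1\<close> by (metis Nat.diff_cancel2)
        also have "\<dots> = (m1 - v') * (l1 + 1)" by (rule diff_mult_distrib [symmetric])
        finally have eq: "(l1 - 1 - x) * (m1 + 1) = (m1 - v') * (l1 + 1)" .
        have "l1 - 1 - x = 0" by (rule coprime_mult_eq_less_imp_zero[OF 3(1) eq]) simp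
        then show ?thesis using eq h(1-3) \<open>y = 1\<close> by simp
      qed
    qed (use \<open>m1 < l1\<close> 3 in auto)
    then show ?thesis using \<open>m1 < l1\<close> by simp
  qed
qed

theorem theorem1p3:
  fixes l1 m1 :: nat
  assumes "0 < m1" and "m1 \<le> l1"
    and "coprime l1 m1 \<or> coprime (l1 + 1) m1 \<or> (coprime (l1 + 1) (m1 + 1) \<and> 2 * m1 \<ge> l1)"
  shows "r_initial (l1 + 1) (int l1) (int m1) \<and>
    (\<exists>(l, m) \<in> hilbert_basis (kostka_cone (l1 + 1)).
       Poly_Mapping.lookup l 1 = real l1 \<and> Poly_Mapping.lookup m 1 = real m1 \<and>
       (\<exists>F. F face_of kostka_cone (l1 + 1) \<and> dim F = 2 \<and> (l, m) \<in> F))"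
  using kostka_hilbert_basis_on_2_face[OF assms] unfolding r_initial_def by fastforce

end
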